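(* Let $p,q\in\mathbb{Z}_+=\{0,1,2,\dots\}$ be some fixed numbers, and let $a_1,\dots,a_p;\ b_1,\dots,b_q$ be some parameters from $\mathbb{C}\setminus\{0,-1,-2,\dots\}$. For $n\in\mathbb{Z}_+$ put $$g_n(z)=\sum_{k=0}^n\frac{(a_1)_k\cdots(a_p)_k}{(b_1)_k\cdots(b_q)_k}\frac{z^k}{k!},$$ and let $$G_n(z)=\frac{n!\,(b_1)_n\cdots(b_q)_n}{(a_1)_n\cdots(a_p)_n}\,g_n(z)$$ be the corresponding monic polynomials. The following statements hold. (a) The polynomials $g_n(z)$ satisfy the recurrence relation $$\frac{(n+1)(b_1+n)\cdots(b_q+n)}{(a_1+n)\cdots(a_p+n)}\bigl(g_{n+1}(z)-g_n(z)\bigr)=z\bigl(g_n(z)-g_{n-1}(z)\bigr),\qquad n\in\mathbb{Z}_+,\quad g_{-1}(z):=0.$$ (b) The monic polynomials $G_n(z)$ satisfy the recurrence relation $$G_n(z)=(z+\delta_n)G_{n-1}(z)-\delta_{n-1}\,z\,G_{n-2}(z),\qquad n=1,2,\dots,$$ where $G_{-1}(z):=0$, $\delta_0:=0$, and $$\delta_k:=\frac{k(b_1+k-1)\cdots(b_q+k-1)}{(a_1+k-1)\cdots(a_p+k-1)},\qquad k\in\mathbb{N}.$$ Therefore the $G_n(z)$ are related to general $T$-fractions and biorthogonal rational functions. (c) The polynomials $g_n(z)$ obey the differential equation $$\theta R g_n(z)-nRg_n(z)=0,\qquad n\in\mathbb{Z}_+,$$ where $$R=\frac{d}{dz}\prod_{j=1}^q(\theta+b_j-1)-\prod_{j=1}^p(a_j+\theta),\qquad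 \theta:=z\frac{d}{dz}.$$ (d) The polynomials $g_n(z)$ are Sobolev orthogonal polynomials on the unit circle: $$\int_{\mathbb{T}}\bigl(g_n(z),g_n'(z),\dots,g_n^{(\rho)}(z)\bigr)\,M\,\overline{\begin{pmatrix}g_m(z)\\ g_m'(z)\\ \vdots\\ g_m^{(\rho)}(z)\end{pmatrix}}\,d\mu_0=\delta_{n,m},\qquad n,m\in\mathbb{Z}_+,$$ where $$M=(c_0(z),c_1(z),\dots,c_\rho(z))^T\,(\overline{c_0(z)},\overline{c_1(z)},\dots,\overline{c_\rho(z)}),$$ and the polynomials $c_j(z)$ (with complex coefficients) are the coefficients of the differential operator $$-\frac{n!\,(b_1)_n\cdots(b_q)_n}{(a_1)_{n+1}\cdots(a_p)_{n+1}}\,R=\sum_{l=0}^{\rho}c_l(z)\frac{d^l}{dz^l},$$ with $\rho=\max(p,q+1)$.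
   Context: $(c)_0=1$ and $(c)_k=c(c+1)\cdots(c+k-1)$ for $k\in\mathbb{N}=\{1,2,\dots\}$ (Pochhammer symbol). The case $p=0$ (respectively $q=0$) means that the $a_j$ (respectively the $b_l$) are absent; then all $(a_j)_k$, $(a_j+k)$ (respectively $(b_l)_k$, $(b_l+k)$) in the formulas are replaced by $1$, and the same is done with the products $\prod_{j=1}^p$ (respectively $\prod_{j=1}^q$). $\mathbb{T}=\{z\in\mathbb{C}:|z|=1\}$, and $\mu_0$ is the normalized (probability) arc length measure on $\mathbb{T}$. In (d), $\delta_{n,m}$ is the Kronecker delta, the superscript $T$ denotes transposition, and the bar denotes complex conjugation. Background for the last sentence of (b): an $R_I$-type continued fraction is associated with a system of monic polynomials $\{P_n(z)\}_{n\ge0}$ generated by $P_n(z)=(z-\mathbf{c}_n)P_{n-1}(z)-\lambda_n(z-\mathbf{a}_n)P_{n-2}(z)$, $n=1,2,\dots$, $P_{-1}:=0$, $P_0:=1$, with $\lambda_{n+1}\neq0$, $P_n(\mathbf{a}_n)\neq0$; such polynomials are related to biorthogonal rational functions (Ismail and Masson, 1995), and the case $\mathbf{a}_n=0$, $n\ge2$, is related to general $T$-fractions. *)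

theory Defs
  imports "HOL-Analysis.Analysis" "HOL-Computational_Algebra.Polynomial"
begin

text \<open>Only the values \<open>a 1, \<dots>, a p\<close> and \<open>b 1, \<dots>, b q\<close> of the parameter
  functions \<open>a\<close>, \<open>b\<close> are ever used. Empty products are \<open>1\<close>, which covers
  \<open>p = 0\<close> and \<open>q = 0\<close>.\<close>

definition hyp_g :: "nat \<Rightarrow> nat \<Rightarrow> (nat \<Rightarrow> complex) \<Rightarrow> (nat \<Rightarrow> complex) \<Rightarrow> nat \<Rightarrow> complex poly" where
  "hyp_g p q a b n =
     (\<Sum>k=0..n. monom ((\<Prod>j=1..p. pochhammer (a j) k) / (\<Prod>l=1..q. pochhammer (b l) k) / fact k) k)"

definition hyp_G :: "nat \<Rightarrow> nat \<Rightarrow> (nat \<Rightarrow> complex) \<Rightarrow> (nat \<Rightarrow> complex) \<Rightarrow> nat \<Rightarrow> complex poly" where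
  "hyp_G p q a b n =
     smult (fact n * (\<Prod>l=1..q. pochhammer (b l) n) / (\<Prod>j=1..p. pochhammer (a j) n)) (hyp_g p q a b n)"

definition hyp_delta :: "nat \<Rightarrow> nat \<Rightarrow> (nat \<Rightarrow> complex) \<Rightarrow> (nat \<Rightarrow> complex) \<Rightarrow> nat \<Rightarrow> complex" where
  "hyp_delta p q a b k =
     (if k = 0 then 0
      else of_nat k * (\<Prod>l=1..q. b l + of_nat k - 1) / (\<Prod>j=1..p. a j + of_nat k - 1))"

text \<open>Systems of monic polynomials of \<open>R\<^sub>I\<close> type (Ismail and Masson, 1995), with the
  convention \<open>P\<^sub>-\<^sub>1 = 0\<close>; the values \<open>\<lambda>\<^sub>1\<close> and \<open>a\<^sub>1\<close> are
  multiplied by \<open>P\<^sub>-\<^sub>1\<close> and hence do not influence the recurrence. General \<open>T\<close>-fractions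
  are the case \<open>a\<^sub>n = 0\<close> for \<open>n \<ge> 2\<close>.\<close>

definition RI_system ::
    "(nat \<Rightarrow> complex poly) \<Rightarrow> (nat \<Rightarrow> complex) \<Rightarrow> (nat \<Rightarrow> complex) \<Rightarrow> (nat \<Rightarrow> complex) \<Rightarrow> bool" where
  "RI_system P c lam a \<longleftrightarrow>
     P 0 = 1 \<and>
     (\<forall>n\<ge>1. P n = [:- c n, 1:] * P (n - 1)
                    - smult (lam n) ([:- a n, 1:] * (if n = 1 then 0 else P (n - 2)))) \<and>
     (\<forall>n\<ge>1. lam (n + 1) \<noteq> 0 \<and> poly (P n) (a n) \<noteq> 0)"

text \<open>Differential operators with polynomial coefficients are represented by their action on
  complex polynomials; a product of operators is a composition.\<close>

definition theta :: "complex poly \<Rightarrow> complex poly" where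
  "theta f = [:0, 1:] * pderiv f"

definition op_prod :: "(nat \<Rightarrow> complex poly \<Rightarrow> complex poly) \<Rightarrow> nat \<Rightarrow> complex poly \<Rightarrow> complex poly" where
  "op_prod A n = foldr (\<circ>) (map A [1..<Suc n]) id"

definition hyp_R :: "nat \<Rightarrow> nat \<Rightarrow> (nat \<Rightarrow> complex) \<Rightarrow> (nat \<Rightarrow> complex) \<Rightarrow> complex poly \<Rightarrow> complex poly" where
  "hyp_R p q a b f =
     pderiv (op_prod (\<lambda>j h. theta h + smult (b j - 1) h) q f)
     - op_prod (\<lambda>j h. smult (a j) h + theta h) p f"

text \<open>\<open>T = (\<Sum>l\<le>r. c\<^sub>l(z) d\<^sup>l/dz\<^sup>l)\<close>. The coefficients beyond \<open>r\<close> are set to zero so that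
  \<open>c\<close> is determined by \<open>T\<close>.\<close>

definition has_diff_coeffs ::
    "(complex poly \<Rightarrow> complex poly) \<Rightarrow> nat \<Rightarrow> (nat \<Rightarrow> complex poly) \<Rightarrow> bool" where
  "has_diff_coeffs T r c \<longleftrightarrow>
     (\<forall>f. T f = (\<Sum>l=0..r. c l * (pderiv ^^ l) f)) \<and> (\<forall>l>r. c l = 0)"

definition scaled_R ::
    "nat \<Rightarrow> nat \<Rightarrow> (nat \<Rightarrow> complex) \<Rightarrow> (nat \<Rightarrow> complex) \<Rightarrow> nat \<Rightarrow> complex poly \<Rightarrow> complex poly" where
  "scaled_R p q a b n f =
     smult (- (fact n * (\<Prod>l=1..q. pochhammer (b l) n) / (\<Prod>j=1..p. pochhammer (a j) (n + 1))))
       (hyp_R p q a b f)"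

text \<open>Normalized arc length on the unit circle, as a Borel measure on the complex plane.\<close>

definition circle_measure :: "complex measure" where
  "circle_measure = distr (uniform_measure lborel {0..2 * pi}) borel cis"

definition sobolev_matrix :: "(nat \<Rightarrow> complex poly) \<Rightarrow> complex \<Rightarrow> nat \<Rightarrow> nat \<Rightarrow> complex" where
  "sobolev_matrix c z i j = poly (c i) z * cnj (poly (c j) z)"

text \<open>The row vector \<open>(f, f', \<dots>, f\<^sup>(\<^sup>r\<^sup>))\<close>, times the matrix, times the conjugated column
  vector of the derivatives of \<open>h\<close>, integrated over the unit circle.\<close>

definition sobolev_form ::
    "nat \<Rightarrow> (nat \<Rightarrow> complex poly) \<Rightarrow> complex poly \<Rightarrow> complex poly \<Rightarrow> complex" where
  "sobolev_form r c f h =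
     (LINT z:sphere 0 1|circle_measure.
        (\<Sum>i=0..r. \<Sum>j=0..r.
           poly ((pderiv ^^ i) f) z * sobolev_matrix c z i j * cnj (poly ((pderiv ^^ j) h) z)))"

end

theory Submission
  imports Defs
begin

text \<open>Write \<open>u\<^sub>k\<close> for the coefficient of \<open>z\<^sup>k\<close> in \<open>g\<^sub>n\<close>, \<open>n \<ge> k\<close>. Everything follows from
  \<open>u\<^sub>k\<^sub>+\<^sub>1 \<delta>\<^sub>k\<^sub>+\<^sub>1 = u\<^sub>k\<close>. It gives (a), and (b) is (a) multiplied by \<open>1 / u\<^sub>n\<^sub>-\<^sub>1\<close>.
  The operator \<open>R\<close> maps \<open>z\<^sup>k\<close> to a combination of \<open>z\<^sup>k\<^sup>-\<^sup>1\<close> and \<open>z\<^sup>k\<close>, and the same relation makes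
  \<open>R g\<^sub>n\<close> telescope to a multiple of \<open>z\<^sup>n\<close>, which is an eigenvector of \<open>\<theta>\<close>; this is (c).
  The scaling in (d) makes the multiple \<open>1\<close>, and the Sobolev form factors as the
  \<open>L\<^sup>2\<close> inner product of \<open>T g\<^sub>n\<close> and \<open>T g\<^sub>m\<close>, \<open>T\<close> being the scaled operator, so that (d) is the
  orthonormality of the monomials on the circle.\<close>

subsection \<open>Differential operators\<close>

lemma coeff_theta: "coeff (theta f) k = of_nat k * coeff f k"
  by (cases k) (simp_all add: theta_def coeff_pderiv)

text \<open>The monomials are common eigenvectors of all factors, \<open>ev j k\<close> being the
  eigenvalue of factor j at z^k, and eigenvalues multiply under composition.\<close>

lemma coeff_comp_diagonal:
  assumes "\<And>j h k. coeff (A j h) k = ev j k * coeff h k"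
  shows "coeff (foldr (\<circ>) (map A xs) id f) k = (\<Prod>j\<leftarrow>xs. ev j k) * coeff f k"
  by (induction xs) (simp_all add: assms mult.assoc)

lemma coeff_op_prod_diagonal:
  fixes ev :: "nat \<Rightarrow> nat \<Rightarrow> complex"
  assumes "\<And>j h k. coeff (A j h) k = ev j k * coeff h k"
  shows "coeff (op_prod A n f) k = (\<Prod>j=1..n. ev j k) * coeff f k"
proof -
  have "(\<Prod>j\<leftarrow>[1..<Suc n]. ev j k) = (\<Prod>j=1..n. ev j k)"
    by (simp add: prod.distinct_set_conv_list [symmetric] atLeastLessThanSuc_atLeastAtMost del: upt_Suc)
  thus ?thesis
    unfolding op_prod_def coeff_comp_diagonal [where ev = ev, OF assms] by simp
qed

text \<open>The outer derivative moves z^(k+1) to z^k, so the q-fold product is evaluated at k + 1,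
  where the shift by 1 in its factors cancels: b_l + (k + 1) - 1 = b_l + k.\<close>

lemma coeff_hyp_R:
  "coeff (hyp_R p q a b f) k =
     of_nat (Suc k) * (\<Prod>l=1..q. b l + of_nat k) * coeff f (Suc k) - (\<Prod>j=1..p. a j + of_nat k) * coeff f k"
proof -
  have B: "coeff (op_prod (\<lambda>j h. theta h + smult (b j - 1) h) q f) i =
             (\<Prod>l=1..q. b l + of_nat i - 1) * coeff f i" for i
    by (rule coeff_op_prod_diagonal) (simp add: coeff_theta algebra_simps)
  have A: "coeff (op_prod (\<lambda>j h. smult (a j) h + theta h) p f) i =
             (\<Prod>j=1..p. a j + of_nat i) * coeff f i" for i
    by (rule coeff_op_prod_diagonal) (simp add: coeff_theta algebra_simps)
  show ?thesis
    unfolding hyp_R_def coeff_diff coeff_pderiv A B by (simp add: algebra_simps)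
qed

section \<open>Existence of the polynomial coefficients of a differential operator\<close>

lemma has_diff_coeffs_mono:
  assumes "has_diff_coeffs T r c" "r \<le> s"
  shows "has_diff_coeffs T s c"
proof -
  have "(\<Sum>l=0..r. c l * (pderiv ^^ l) f) = (\<Sum>l=0..s. c l * (pderiv ^^ l) f)" for f
    by (rule sum.mono_neutral_left) (use assms in \<open>auto simp: has_diff_coeffs_def\<close>)
  thus ?thesis
    using assms by (auto simp: has_diff_coeffs_def)
qed

lemma has_diff_coeffs_id: "has_diff_coeffs (\<lambda>f. f) 0 (\<lambda>l. if l = 0 then 1 else 0)"
  by (simp add: has_diff_coeffs_def)

lemma has_diff_coeffs_add:
  assumes "has_diff_coeffs S r c" "has_diff_coeffs T r d"
  shows "has_diff_coeffs (\<lambda>f. S f + T f) r (\<lambda>l. c l + d l)"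
  using assms by (simp add: has_diff_coeffs_def sum.distrib distrib_right)

lemma has_diff_coeffs_mult:
  assumes "has_diff_coeffs T r c"
  shows "has_diff_coeffs (\<lambda>f. P * T f) r (\<lambda>l. P * c l)"
  using assms by (simp add: has_diff_coeffs_def sum_distrib_left mult.assoc)

lemma has_diff_coeffs_smult:
  assumes "has_diff_coeffs T r c"
  shows "has_diff_coeffs (\<lambda>f. smult s (T f)) r (\<lambda>l. smult s (c l))"
  using has_diff_coeffs_mult [OF assms, of "[:s:]"] by simp

text \<open>Leibniz rule: composing d/dz with c_l D^l gives c_l' D^l + c_l D^(l+1).\<close>

lemma has_diff_coeffs_pderiv:
  assumes "has_diff_coeffs T r c"
  shows "has_diff_coeffs (\<lambda>f. pderiv (T f)) (Suc r)
           (\<lambda>l. pderiv (c l) + (case l of 0 \<Rightarrow> 0 | Suc i \<Rightarrow> c i))"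
proof -
  have T: "T f = (\<Sum>l\<le>r. c l * (pderiv ^^ l) f)" and c: "l > r \<Longrightarrow> c l = 0" for f l
    using assms by (auto simp: has_diff_coeffs_def atLeast0AtMost)
  have "pderiv (T f) = (\<Sum>l\<le>r. pderiv (c l) * (pderiv ^^ l) f) + (\<Sum>l\<le>r. c l * (pderiv ^^ Suc l) f)" for f
    unfolding T higher_pderiv_sum [where n = 1, simplified] pderiv_mult by (simp add: sum.distrib algebra_simps)
  \<comment> \<open>Since \<open>c (Suc r) = 0\<close>, the first sum may run up to
    \<open>Suc r\<close>; the second is shifted by one index, with a zero inserted at l = 0.\<close>
  also have "\<dots> f = (\<Sum>l\<le>Suc r. pderiv (c l) * (pderiv ^^ l) f) +
      (\<Sum>l\<le>Suc r. (case l of 0 \<Rightarrow> 0 | Suc i \<Rightarrow> c i) * (pderiv ^^ l) f)" for f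
    unfolding sum.atMost_Suc_shift [of "\<lambda>l. (case l of 0 \<Rightarrow> 0 | Suc i \<Rightarrow> c i) * (pderiv ^^ l) f"]
    by (simp add: c)
  finally have "pderiv (T f) = (\<Sum>l\<le>Suc r. (pderiv (c l) + (case l of 0 \<Rightarrow> 0 | Suc i \<Rightarrow> c i)) * (pderiv ^^ l) f)" for f
    by (simp only: sum.distrib distrib_right)
  moreover have "pderiv (c l) + (case l of 0 \<Rightarrow> 0 | Suc i \<Rightarrow> c i) = 0" if "l > Suc r" for l
    using that by (cases l) (simp_all add: c)
  ultimately show ?thesis
    by (simp add: has_diff_coeffs_def atLeast0AtMost)
qed

lemma has_diff_coeffs_theta_plus:
  assumes "has_diff_coeffs T r c"
  shows "\<exists>d. has_diff_coeffs (\<lambda>f. theta (T f) + smult s (T f)) (Suc r) d"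
  unfolding theta_def
  \<comment> \<open>The witness stays schematic and is assembled by unification; its explicit form
    is of no interest because coefficients are unique.\<close>
  by (rule exI, rule has_diff_coeffs_add,
      rule has_diff_coeffs_mult, rule has_diff_coeffs_pderiv, rule assms,
      rule has_diff_coeffs_mono [OF has_diff_coeffs_smult [OF assms]], simp)

text \<open>\<open>A\<close> is given by an equation so that both products in \<open>R\<close> are
  covered, whose factors list their summands in opposite orders.\<close>

lemma has_diff_coeffs_op_prod:
  fixes s :: "nat \<Rightarrow> complex"
  assumes A: "\<And>j h. A j h = theta h + smult (s j) h"
  shows "\<exists>c. has_diff_coeffs (op_prod A n) n c"
proof -
  \<comment> \<open>Arbitrary index lists make the induction work: the tail of
    \<open>[1..<Suc n]\<close> no longer starts at 1.\<close>
  have "\<exists>c. has_diff_coeffs (foldr (\<circ>) (map A xs) id) (length xs) c" for xs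
  proof (induction xs)
    case Nil
    show ?case using has_diff_coeffs_id by (auto simp: id_def)
  next
    case (Cons x xs)
    then obtain c where "has_diff_coeffs (foldr (\<circ>) (map A xs) id) (length xs) c" ..
    from has_diff_coeffs_theta_plus [OF this, of "s x"]
    obtain d where d: "has_diff_coeffs (\<lambda>f. theta (foldr (\<circ>) (map A xs) id f) +
        smult (s x) (foldr (\<circ>) (map A xs) id f)) (Suc (length xs)) d" ..
    have "foldr (\<circ>) (map A (x # xs)) id = (\<lambda>f. theta (foldr (\<circ>) (map A xs) id f) +
        smult (s x) (foldr (\<circ>) (map A xs) id f))"
      by (rule ext) (simp only: list.map foldr.simps comp_apply A)
    with d show ?case by (metis length_Cons)
  qed
  from this [of "[1..<Suc n]"] show ?thesis
    by (simp add: op_prod_def del: upt_Suc)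
qed

lemma has_diff_coeffs_hyp_R: "\<exists>c. has_diff_coeffs (hyp_R p q a b) (max p (q + 1)) c"
proof -
  obtain c where c: "has_diff_coeffs (op_prod (\<lambda>j h. theta h + smult (b j - 1) h) q) q c"
    using has_diff_coeffs_op_prod [of "\<lambda>j h. theta h + smult (b j - 1) h" "\<lambda>j. b j - 1"] by blast
  obtain d where d: "has_diff_coeffs (op_prod (\<lambda>j h. smult (a j) h + theta h) p) p d"
    using has_diff_coeffs_op_prod [of "\<lambda>j h. smult (a j) h + theta h" a] by (auto simp: add.commute)
  have "hyp_R p q a b = (\<lambda>f. pderiv (op_prod (\<lambda>j h. theta h + smult (b j - 1) h) q f)
          + smult (-1) (op_prod (\<lambda>j h. smult (a j) h + theta h) p f))"
    by (simp add: fun_eq_iff hyp_R_def)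
  moreover have "\<exists>e. has_diff_coeffs \<dots> (max p (q + 1)) e"
    \<comment> \<open>The two summands have orders q + 1 and p; both are padded with zeros to the
      common order before adding.\<close>
    by (rule exI, rule has_diff_coeffs_add,
        rule has_diff_coeffs_mono [OF has_diff_coeffs_pderiv [OF c]], simp,
        rule has_diff_coeffs_mono [OF has_diff_coeffs_smult [OF d]], simp)
  ultimately show ?thesis by simp
qed

section \<open>Uniqueness of the coefficients\<close>

lemma higher_pderiv_monom_self: "(pderiv ^^ n) (monom 1 n) = [:fact n :: complex:]"
proof (induction n)
  case (Suc n)
  have "pderiv (monom 1 (Suc n)) = smult (of_nat (Suc n)) (monom 1 n :: complex poly)"
    by (simp add: pderiv_monom smult_monom)
  with Suc show ?case
    by (simp add: funpow_Suc_right higher_pderiv_smult del: funpow.simps)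
qed simp

lemma higher_pderiv_monom_less:
  assumes "n < l"
  shows "(pderiv ^^ l) (monom 1 n :: complex poly) = 0"
proof -
  have "l = (l - n - 1) + Suc n" using assms by simp
  hence "(pderiv ^^ l) (monom 1 n :: complex poly) = (pderiv ^^ (l - n - 1)) (pderiv ((pderiv ^^ n) (monom 1 n)))"
    by (metis comp_apply funpow.simps(2) funpow_add)
  thus ?thesis by (simp add: higher_pderiv_monom_self)
qed

text \<open>Testing on z^n gives a triangular system: derivatives of order above n vanish and order
  n contributes n! c_n, so c_n is determined by T and the earlier coefficients. Beyond r both
  sequences are zero by convention.\<close>

lemma has_diff_coeffs_unique:
  assumes "has_diff_coeffs T r c" "has_diff_coeffs T r d"
  shows "c = d"
proof
  fix l
  show "c l = d l"
  proof (induction l rule: less_induct)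
    case (less n)
    show ?case
    proof (cases "n \<le> r")
      case True
      have *: "T (monom 1 n) = (\<Sum>l<n. e l * (pderiv ^^ l) (monom 1 n)) + e n * [:fact n:]"
        if "has_diff_coeffs T r e" for e
      proof -
        have "T (monom 1 n) = (\<Sum>l=0..r. e l * (pderiv ^^ l) (monom 1 n))"
          using that by (simp add: has_diff_coeffs_def)
        also have "\<dots> = (\<Sum>l\<le>n. e l * (pderiv ^^ l) (monom 1 n))"
          by (rule sum.mono_neutral_right) (use True in \<open>auto simp: higher_pderiv_monom_less\<close>)
        finally show ?thesis
          by (simp add: lessThan_Suc_atMost [symmetric] higher_pderiv_monom_self)
      qed
      have "c n * [:fact n:] = d n * [:fact n:]"
        using *[OF assms(1)] *[OF assms(2)] less by simp
      thus ?thesis by (metis fact_nonzero mult_right_cancel pCons_eq_0_iff)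
    qed (use assms in \<open>simp add: has_diff_coeffs_def\<close>)
  qed
qed

subsection \<open>The unit circle\<close>

lemma set_integral_circle_measure:
  fixes f :: "complex \<Rightarrow> complex"
  assumes "continuous_on UNIV f"
  shows "(LINT z:sphere 0 1|circle_measure. f z) = integral {0..2 * pi} (\<lambda>t. f (cis t)) / (2 * pi)"
proof -
  have [measurable]: "f \<in> borel_measurable borel"
    using assms by (rule borel_measurable_continuous_onI)
  have [measurable]: "cis \<in> borel_measurable borel"
    by (intro borel_measurable_continuous_onI continuous_intros)
  have meas: "(\<lambda>z. indicator (sphere 0 1) z *\<^sub>R f z) \<in> borel_measurable borel"
    by (intro borel_measurable_scaleR borel_measurable_indicator borel_closed closed_sphere) measurable
  \<comment> \<open>A real-valued constant density 1/(2 pi) on the interval, in the form that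
    \<open>integral_density\<close> expects.\<close>
  have dens: "uniform_measure lborel {0..2 * pi} = density lborel (\<lambda>t. ennreal (indicator {0..2 * pi} t / (2 * pi)))"
    unfolding uniform_measure_def
    by (intro arg_cong2 [where f = density] refl ext)
       (simp add: indicator_def divide_ennreal [symmetric] ennreal_1 [symmetric] del: ennreal_1 flip: ennreal_0)
  have "(LINT z:sphere 0 1|circle_measure. f z)
      = (LINT t|uniform_measure lborel {0..2 * pi}. indicator (sphere 0 1) (cis t) *\<^sub>R f (cis t))"
    unfolding circle_measure_def set_lebesgue_integral_def
    by (rule integral_distr) (simp add: dens, rule meas)
  \<comment> \<open>The indicator disappears because \<open>cis t\<close> always lies on the
    circle.\<close>
  also have "\<dots> = (LINT t|uniform_measure lborel {0..2 * pi}. f (cis t))"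
    by simp
  also have "\<dots> = (LINT t|lborel. (indicator {0..2 * pi} t / (2 * pi)) *\<^sub>R f (cis t))"
    unfolding dens
  proof (rule integral_density)
    show "(\<lambda>t. f (cis t)) \<in> borel_measurable lborel"
      by measurable
    show "(\<lambda>t. indicator {0..2 * pi} t / (2 * pi)) \<in> borel_measurable lborel"
      by measurable
  qed simp
  also have "\<dots> = (LINT t|lborel. (indicator {0..2 * pi} t *\<^sub>R f (cis t)) / (2 * pi))"
    by (intro Bochner_Integration.integral_cong refl) (simp add: indicator_def scaleR_conv_of_real)
  also have "\<dots> = (LINT t:{0..2 * pi}|lborel. f (cis t)) / (2 * pi)"
    unfolding set_lebesgue_integral_def by (rule integral_divide_zero)
  also have "(LINT t:{0..2 * pi}|lborel. f (cis t)) = integral {0..2 * pi} (\<lambda>t. f (cis t))"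
    by (intro set_borel_integral_eq_integral(2) borel_integrable_atLeastAtMost'
          continuous_on_compose2 [OF assms] continuous_intros) auto
  finally show ?thesis .
qed

lemma integral_cis_multiple:
  fixes k :: int
  shows "integral {0..2 * pi} (\<lambda>t. cis (of_int k * t)) = (if k = 0 then 2 * pi else 0)"
proof (cases "k = 0")
  case False
  \<comment> \<open>For k nonzero the antiderivative cis(kt)/(ik) takes equal values at both ends,
    as k is an integer.\<close>
  have "((\<lambda>t. cis (of_int k * t)) has_integral
          cis (of_int k * (2 * pi)) / (\<i> * of_int k) - cis (of_int k * 0) / (\<i> * of_int k)) {0..2 * pi}"
  proof (rule fundamental_theorem_of_calculus)
    fix t :: real
    have "((\<lambda>t. exp (\<i> * of_int k * of_real t) / (\<i> * of_int k)) has_vector_derivative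
            exp (\<i> * of_int k * of_real t)) (at t within {0..2 * pi})"
      by (rule has_vector_derivative_real_field)
         (use False in \<open>auto intro!: derivative_eq_intros\<close>)
    thus "((\<lambda>t. cis (of_int k * t) / (\<i> * of_int k)) has_vector_derivative cis (of_int k * t))
            (at t within {0..2 * pi})"
      by (simp add: cis_conv_exp mult_ac)
  qed simp
  moreover have "cis (of_int k * (2 * pi)) = 1"
    using cis_multiple_2pi [of "of_int k"] by (simp add: mult_ac)
  ultimately show ?thesis
    using False by (simp add: integral_unique)
qed (simp add: scaleR_conv_of_real)

lemma circle_monomials_orthonormal:
  "(LINT z:sphere 0 1|circle_measure. z ^ n * cnj (z ^ m)) = (if n = m then 1 else 0)"
proof -
  have "(LINT z:sphere 0 1|circle_measure. z ^ n * cnj (z ^ m))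
      = integral {0..2 * pi} (\<lambda>t. cis t ^ n * cnj (cis t ^ m)) / (2 * pi)"
    by (rule set_integral_circle_measure) (intro continuous_intros)
  \<comment> \<open>Conjugation is inversion on the circle; the exponent n - m may be negative,
    hence \<open>int\<close>.\<close>
  also have "(\<lambda>t. cis t ^ n * cnj (cis t ^ m)) = (\<lambda>t. cis (of_int (int n - int m) * t))"
    by (simp add: fun_eq_iff Complex.DeMoivre cis_cnj cis_mult algebra_simps)
  finally show ?thesis
    by (simp add: integral_cis_multiple del: of_int_diff)
qed

text \<open>The matrix has the rank-one form c c^*, so the double sum splits into T f times the
  conjugate of T h.\<close>

lemma sobolev_form_eq:
  assumes "has_diff_coeffs T r c"
  shows "sobolev_form r c f h = (LINT z:sphere 0 1|circle_measure. poly (T f) z * cnj (poly (T h) z))"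
proof -
  have T: "poly (T f) z = (\<Sum>l=0..r. poly (c l) z * poly ((pderiv ^^ l) f) z)" for f z
    using assms by (simp add: has_diff_coeffs_def poly_sum)
  show ?thesis
    unfolding sobolev_form_def T sobolev_matrix_def cnj_sum sum_product
    by (simp add: mult_ac)
qed

subsection \<open>The hypergeometric partial sums\<close>

text \<open>The u_k of the opening text. They do not depend on n: all g_n are partial sums of one
  power series.\<close>

definition hyp_coeff :: "nat \<Rightarrow> nat \<Rightarrow> (nat \<Rightarrow> complex) \<Rightarrow> (nat \<Rightarrow> complex) \<Rightarrow> nat \<Rightarrow> complex" where
  "hyp_coeff p q a b k = (\<Prod>j=1..p. pochhammer (a j) k) / (\<Prod>l=1..q. pochhammer (b l) k) / fact k"

lemma coeff_hyp_g: "coeff (hyp_g p q a b n) k = (if k \<le> n then hyp_coeff p q a b k else 0)"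
  unfolding hyp_g_def hyp_coeff_def [symmetric] coeff_sum coeff_monom by simp

lemma hyp_delta_Suc:
  "hyp_delta p q a b (Suc n) = of_nat (Suc n) * (\<Prod>l=1..q. b l + of_nat n) / (\<Prod>j=1..p. a j + of_nat n)"
  by (simp add: hyp_delta_def)

lemma hyp_G_eq: "hyp_G p q a b n = smult (1 / hyp_coeff p q a b n) (hyp_g p q a b n)"
  by (simp add: hyp_G_def hyp_coeff_def field_simps)

context
  fixes p q :: nat and a b :: "nat \<Rightarrow> complex"
  assumes a: "\<forall>j\<in>{1..p}. a j \<notin> \<int>\<^sub>\<le>\<^sub>0"
      and b: "\<forall>l\<in>{1..q}. b l \<notin> \<int>\<^sub>\<le>\<^sub>0"
begin

lemma prod_shift_nonzero:
  "(\<Prod>j=1..p. a j + of_nat n) \<noteq> 0" "(\<Prod>l=1..q. b l + of_nat n) \<noteq> 0"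
  using a b by (auto dest: plus_of_nat_eq_0_imp)

lemma prod_pochhammer_nonzero:
  "(\<Prod>j=1..p. pochhammer (a j) n) \<noteq> 0" "(\<Prod>l=1..q. pochhammer (b l) n) \<noteq> 0"
  using a b by (auto dest: pochhammer_eq_0_imp_nonpos_Int)

lemma hyp_coeff_nonzero: "hyp_coeff p q a b k \<noteq> 0"
  using prod_pochhammer_nonzero by (simp add: hyp_coeff_def)

lemma hyp_delta_Suc_nonzero: "hyp_delta p q a b (Suc n) \<noteq> 0"
  using prod_shift_nonzero [of n] by (simp add: hyp_delta_Suc del: of_nat_Suc)

lemma hyp_coeff_Suc:
  "of_nat (Suc k) * (\<Prod>l=1..q. b l + of_nat k) * hyp_coeff p q a b (Suc k)
     = (\<Prod>j=1..p. a j + of_nat k) * hyp_coeff p q a b k"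
proof -
  \<comment> \<open>P, Q, F are the two Pochhammer products and the factorial at k; A, B, N are the
    factors gained at k + 1. Only N and B are cancelled.\<close>
  have "N * B * (P * A / (Q * B) / (N * F)) = A * (P / Q / F)"
    if "N \<noteq> 0" "B \<noteq> 0" for N B P A Q F :: complex
    using that by simp
  from this [OF of_nat_neq_0 prod_shift_nonzero(2)] show ?thesis
    by (simp only: hyp_coeff_def pochhammer_Suc prod.distrib fact_Suc of_nat_mult)
qed

lemma hyp_delta_coeff: "hyp_delta p q a b (Suc k) * hyp_coeff p q a b (Suc k) = hyp_coeff p q a b k"
  using hyp_coeff_Suc [of k] prod_shift_nonzero [of k] unfolding hyp_delta_Suc by (simp add: field_simps)

section \<open>Recurrences (a) and (b)\<close>

lemma hyp_g_Suc_diff: "hyp_g p q a b (Suc n) - hyp_g p q a b n = monom (hyp_coeff p q a b (Suc n)) (Suc n)"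
  by (rule poly_eqI) (auto simp: coeff_hyp_g)

text \<open>Both differences are single monomials, u_(n+1) z^(n+1) and u_n z^n; for n = 0 the
  convention g_(-1) = 0 fits since g_0 = u_0.\<close>

lemma hyp_g_recurrence:
  "smult (hyp_delta p q a b (Suc n)) (hyp_g p q a b (Suc n) - hyp_g p q a b n)
     = [:0, 1:] * (hyp_g p q a b n - (if n = 0 then 0 else hyp_g p q a b (n - 1)))"
proof -
  have "hyp_g p q a b n - (if n = 0 then 0 else hyp_g p q a b (n - 1)) = monom (hyp_coeff p q a b n) n"
    by (rule poly_eqI) (auto simp: coeff_hyp_g)
  thus ?thesis
    by (simp add: hyp_g_Suc_diff hyp_delta_coeff smult_monom monom_Suc)
qed

lemma hyp_G_monic: "degree (hyp_G p q a b n) = n" "lead_coeff (hyp_G p q a b n) = 1"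
proof -
  have c: "coeff (hyp_G p q a b n) k = (if k \<le> n then hyp_coeff p q a b k / hyp_coeff p q a b n else 0)" for k
    by (simp add: hyp_G_eq coeff_hyp_g)
  have "degree (hyp_G p q a b n) \<le> n"
    by (rule degree_le) (simp add: c)
  moreover have "degree (hyp_G p q a b n) \<ge> n"
    by (rule le_degree) (simp add: c hyp_coeff_nonzero)
  ultimately show "degree (hyp_G p q a b n) = n" by simp
  thus "lead_coeff (hyp_G p q a b n) = 1"
    by (simp add: c hyp_coeff_nonzero)
qed

lemma hyp_G_Suc_recurrence:
  "hyp_G p q a b (Suc n) = [:hyp_delta p q a b (Suc n), 1:] * hyp_G p q a b n
     - smult (hyp_delta p q a b n) ([:0, 1:] * (if n = 0 then 0 else hyp_G p q a b (n - 1)))"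
proof -
  define u where "u = hyp_coeff p q a b"
  define g where "g = hyp_g p q a b"
  define d where "d = hyp_delta p q a b"
  have u: "u k \<noteq> 0" and du: "d (Suc k) * u (Suc k) = u k" for k
    by (simp_all add: u_def d_def hyp_coeff_nonzero hyp_delta_coeff)
  have G: "hyp_G p q a b k = smult (1 / u k) (g k)" for k
    by (simp add: hyp_G_eq u_def g_def)
  \<comment> \<open>Dividing (a) by u_n thus turns its g_(n+1) term into G_(n+1).\<close>
  have 1: "smult (d (Suc n) / u n) (g k) = smult (1 / u (Suc n)) (g k)" for k
  proof -
    have "d (Suc n) / u n = 1 / u (Suc n)"
      using u [of n] u [of "Suc n"] du [of n] by (simp add: field_simps)
    thus ?thesis by simp
  qed
  \<comment> \<open>Likewise the g_(n-1) term becomes delta_n G_(n-1); for n = 0 both sides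
    vanish.\<close>
  have 2: "smult (d n) (if n = 0 then 0 else hyp_G p q a b (n - 1)) = smult (1 / u n) (if n = 0 then 0 else g (n - 1))"
  proof (cases n)
    case (Suc m)
    have "d n / u m = 1 / u n"
      using u [of m] u [of n] du [of m] Suc by (simp add: field_simps)
    thus ?thesis by (simp add: G Suc)
  qed simp
  have "smult (1 / u n) (smult (d (Suc n)) (g (Suc n) - g n))
          = smult (1 / u n) ([:0, 1:] * (g n - (if n = 0 then 0 else g (n - 1))))"
    using hyp_g_recurrence [of n] by (simp only: d_def g_def)
  hence "smult (1 / u (Suc n)) (g (Suc n)) - smult (d (Suc n)) (smult (1 / u n) (g n))
          = [:0, 1:] * smult (1 / u n) (g n) - [:0, 1:] * smult (1 / u n) (if n = 0 then 0 else g (n - 1))"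
    using 1 [of "Suc n"] by (simp add: smult_diff_right right_diff_distrib mult.commute)
  thus ?thesis
    unfolding d_def [symmetric] mult_smult_right [symmetric] 2
    unfolding G by (simp add: algebra_simps smult_add_right)
qed

text \<open>Makes the link with T-fractions precise: all nodes are 0. Nondegeneracy holds because
  lambda_(n+1) = delta_n is nonzero for n >= 1 and G_n(0) = u_0 / u_n.\<close>

lemma RI_system_hyp_G:
  "RI_system (hyp_G p q a b) (\<lambda>n. - hyp_delta p q a b n) (\<lambda>n. hyp_delta p q a b (n - 1)) (\<lambda>n. 0)"
  unfolding RI_system_def
proof (intro conjI allI impI)
  show "hyp_G p q a b 0 = 1"
    by (simp add: hyp_G_def hyp_g_def)
next
  fix n :: nat assume "n \<ge> 1"
  then obtain m where [simp]: "n = Suc m" by (cases n) auto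
  show "hyp_G p q a b n = [:- (- hyp_delta p q a b n), 1:] * hyp_G p q a b (n - 1)
      - smult (hyp_delta p q a b (n - 1)) ([:- 0, 1:] * (if n = 1 then 0 else hyp_G p q a b (n - 2)))"
    using hyp_G_Suc_recurrence [of m] by simp
  show "hyp_delta p q a b (n + 1 - 1) \<noteq> 0"
    using hyp_delta_Suc_nonzero [of m] by simp
  show "poly (hyp_G p q a b n) 0 \<noteq> 0"
    by (simp add: hyp_G_eq poly_0_coeff_0 coeff_hyp_g hyp_coeff_nonzero)
qed

section \<open>The image of g_n under \<open>R\<close>, and orthogonality\<close>

lemma hyp_R_hyp_g:
  "hyp_R p q a b (hyp_g p q a b n) = monom (- ((\<Prod>j=1..p. a j + of_nat n) * hyp_coeff p q a b n)) n"
proof (rule poly_eqI)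
  fix k
  show "coeff (hyp_R p q a b (hyp_g p q a b n)) k
      = coeff (monom (- ((\<Prod>j=1..p. a j + of_nat n) * hyp_coeff p q a b n)) n) k"
    \<comment> \<open>For k < n the two terms cancel; at k = n truncation removes the first; for k >
      n both are zero.\<close>
    using hyp_coeff_Suc [of k] by (cases k n rule: linorder_cases) (simp_all add: coeff_hyp_R coeff_hyp_g del: of_nat_Suc)
qed

text \<open>As (a_j)_(n+1) = (a_j)_n (a_j + n), the scaling factor is exactly the inverse of the
  coefficient in \<open>hyp_R_hyp_g\<close>.\<close>

lemma scaled_R_hyp_g: "scaled_R p q a b n (hyp_g p q a b n) = monom 1 n"
  using prod_shift_nonzero [of n] prod_pochhammer_nonzero [of n]
  by (simp add: scaled_R_def hyp_R_hyp_g smult_monom hyp_coeff_def pochhammer_Suc prod.distrib)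

lemma sobolev_form_hyp_g:
  assumes "has_diff_coeffs (scaled_R p q a b n) r c"
  shows "sobolev_form r c (hyp_g p q a b n) (hyp_g p q a b m) = (if n = m then 1 else 0)"
proof -
  \<comment> \<open>The scaling belongs to n, so g_m is only mapped to a multiple of z^m; s = 1 is
    known just for m = n, and otherwise orthogonality makes s irrelevant.\<close>
  obtain s where s: "scaled_R p q a b n (hyp_g p q a b m) = monom s m"
    by (simp add: scaled_R_def hyp_R_hyp_g smult_monom)
  have "sobolev_form r c (hyp_g p q a b n) (hyp_g p q a b m)
      = (LINT z:sphere 0 1|circle_measure. cnj s * (z ^ n * cnj (z ^ m)))"
    unfolding sobolev_form_eq [OF assms] s scaled_R_hyp_g by (simp add: poly_monom mult_ac)
  also have "\<dots> = cnj s * (if n = m then 1 else 0)"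
    unfolding set_integral_mult_right circle_monomials_orthonormal ..
  also have "\<dots> = (if n = m then 1 else 0)"
    using s scaled_R_hyp_g by auto
  finally show ?thesis .
qed

end

theorem theorem1:
  fixes p q :: nat and a b :: "nat \<Rightarrow> complex"
  assumes "\<And>j. j \<in> {1..p} \<Longrightarrow> a j \<notin> \<int>\<^sub>\<le>\<^sub>0"
      and "\<And>l. l \<in> {1..q} \<Longrightarrow> b l \<notin> \<int>\<^sub>\<le>\<^sub>0"
  shows
    "(\<forall>n. smult (of_nat (n + 1) * (\<Prod>l=1..q. b l + of_nat n) / (\<Prod>j=1..p. a j + of_nat n))
             (hyp_g p q a b (n + 1) - hyp_g p q a b n)
           = [:0, 1:] * (hyp_g p q a b n - (if n = 0 then 0 else hyp_g p q a b (n - 1))))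
     \<and>
     (\<forall>n. degree (hyp_G p q a b n) = n \<and> lead_coeff (hyp_G p q a b n) = 1)
     \<and>
     (\<forall>n\<ge>1. hyp_G p q a b n
           = [:hyp_delta p q a b n, 1:] * hyp_G p q a b (n - 1)
             - smult (hyp_delta p q a b (n - 1))
                 ([:0, 1:] * (if n = 1 then 0 else hyp_G p q a b (n - 2))))
     \<and>
     RI_system (hyp_G p q a b)
       (\<lambda>n. - hyp_delta p q a b n) (\<lambda>n. hyp_delta p q a b (n - 1)) (\<lambda>n. 0)
     \<and>
     (\<forall>n. theta (hyp_R p q a b (hyp_g p q a b n))
           - smult (of_nat n) (hyp_R p q a b (hyp_g p q a b n)) = 0)
     \<and>
     (\<forall>n. \<exists>!c. has_diff_coeffs (scaled_R p q a b n) (max p (q + 1)) c)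
     \<and>
     (\<forall>n m c. has_diff_coeffs (scaled_R p q a b n) (max p (q + 1)) c \<longrightarrow>
           sobolev_form (max p (q + 1)) c (hyp_g p q a b n) (hyp_g p q a b m)
             = (if n = m then 1 else 0))"
proof (intro conjI allI impI)
  have ab: "\<forall>j\<in>{1..p}. a j \<notin> \<int>\<^sub>\<le>\<^sub>0" "\<forall>l\<in>{1..q}. b l \<notin> \<int>\<^sub>\<le>\<^sub>0"
    using assms by blast+
  fix n
  show "smult (of_nat (n + 1) * (\<Prod>l=1..q. b l + of_nat n) / (\<Prod>j=1..p. a j + of_nat n))
          (hyp_g p q a b (n + 1) - hyp_g p q a b n)
        = [:0, 1:] * (hyp_g p q a b n - (if n = 0 then 0 else hyp_g p q a b (n - 1)))"
    using hyp_g_recurrence [OF ab, of n] unfolding hyp_delta_Suc by simp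
  show "degree (hyp_G p q a b n) = n" "lead_coeff (hyp_G p q a b n) = 1"
    by (rule hyp_G_monic [OF ab])+
  show "theta (hyp_R p q a b (hyp_g p q a b n)) - smult (of_nat n) (hyp_R p q a b (hyp_g p q a b n)) = 0"
    by (rule poly_eqI) (simp add: coeff_theta hyp_R_hyp_g [OF ab])
  show "\<exists>!c. has_diff_coeffs (scaled_R p q a b n) (max p (q + 1)) c"
    using has_diff_coeffs_hyp_R [of p q a b] has_diff_coeffs_unique has_diff_coeffs_smult
    unfolding scaled_R_def by blast
  show "RI_system (hyp_G p q a b) (\<lambda>n. - hyp_delta p q a b n) (\<lambda>n. hyp_delta p q a b (n - 1)) (\<lambda>n. 0)"
    by (rule RI_system_hyp_G [OF ab])
  \<comment> \<open>Recurrence (b) is read off from the system with c_n = -delta_n and nodes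
    0.\<close>
  then show "hyp_G p q a b n = [:hyp_delta p q a b n, 1:] * hyp_G p q a b (n - 1)
      - smult (hyp_delta p q a b (n - 1)) ([:0, 1:] * (if n = 1 then 0 else hyp_G p q a b (n - 2)))"
    if "n \<ge> 1" for n
    using that unfolding RI_system_def by simp
  fix m c
  assume "has_diff_coeffs (scaled_R p q a b n) (max p (q + 1)) c"
  then show "sobolev_form (max p (q + 1)) c (hyp_g p q a b n) (hyp_g p q a b m) = (if n = m then 1 else 0)"
    by (rule sobolev_form_hyp_g [OF ab])
qed

end
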